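(* Let $\lambda=(\lambda_1,\lambda_2)$ with $\lambda_1\ge\lambda_2>0$, and consider the partition functions $Z^{\lambda}_{\sigma,w}(x_1,x_2;y_1,\dots,y_{\lambda_1})$ for $\sigma,w\in S_2=\{e,s\}$. Case 1: If $\sigma\ne w$, then $Z^\lambda_{\sigma,w}$ has exactly one admissible state (so it only exhibits local vanishing). It vanishes precisely when $x_1=y_k$ for some $1\le k<\lambda_1$ or $x_2=y_k$ for some $1\le k<\lambda_2$. Case 2: If $\sigma=w=e$, then $Z^\lambda_{\sigma,w}$ has $\lambda_1-\lambda_2+1$ admissible states. It exhibits local vanishing (all states vanish) if $x_i=y_k$ for some $1\le k<\lambda_2$ and $i=1$ or $2$. It exhibits global vanishing if $x_1=y_k$ and $x_2=t^{-1}y_k$ for some $k$ with $\lambda_2\le k<\lambda_1$.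
   Context: Lattice model: a grid with $2$ rows numbered $1,2$ from top to bottom and $\lambda_1$ columns numbered $1,\dots,\lambda_1$ from right to left; $t$ is an indeterminate, and the vertex in row $i$, column $j$ has parameters $x=x_i$, $y=y_j$. Horizontal edges carry a spin in $\{+,1,2\}$ ($+$ = uncolored), vertical edges carry a subset of the color set $\{1<2\}$. The weight of a vertex with left spin $L$, top spin $\Sigma$, right spin $L'$, bottom spin $\Sigma'$, written $(L,\Sigma;L',\Sigma')$, is as listed; configurations not listed are not allowed (weight zero). $\Sigma_{>c},\Sigma_{<c},\Sigma_{(c,d)}$ denote the elements of $\Sigma$ that are $>c$, $<c$, strictly between $c$ and $d$. (1) $(+,\Sigma;+,\Sigma)$: $(-t)^{|\Sigma|}$. (2) $(c,\Sigma;c,\Sigma)$: $t^{|\Sigma_{>c}|}(-xy^{-1}+t^{\delta})$ with $\delta=1$ if $c\in\Sigma$, else $0$. (3) $(+,\Sigma;c,\Sigma\setminus\{c\})$, $c\in\Sigma$: $(-t)^{|\Sigma_{<c}|}t^{|\Sigma_{>c}|}$. (4) $(c,\Sigma;+,\Sigma\cup\{c\})$, $c\notin\Sigma$: $-(1-t)xy^{-1}(-t)^{|\Sigma_{>c}|}$. (5) $(c,\Sigma;d,(\Sigma\cup\{c\})\setminus\{d\})$, $c<d$, $d\in\Sigma$, $c\notin\Sigma$: $-(1-t)xy^{-1}(-t)^{|\Sigma_{(c,d)}|}t^{|\Sigma_{>d}|}$. (6) $(d,\Sigma;c,(\Sigma\cup\{d\})\setminus\{c\})$, $c<d$, $c\in\Sigma$,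 $d\notin\Sigma$: $-(1-t)(-1)^{|\Sigma_{(c,d)}|}t^{|\Sigma_{>d}|}$. Boundary conditions for $(\sigma,w,\lambda)$: the top boundary edge in column $\lambda_1$ carries color $\sigma(2)$ and that in column $\lambda_2$ carries color $\sigma(1)$ (both colors if $\lambda_1=\lambda_2$), other top edges are empty; the right boundary edge in row $i$ has color $w(i)$; left and bottom boundary edges are uncolored. An admissible state is an assignment of spins to interior edges such that every vertex is of one of the types (1)–(6); its weight is the product of its vertex weights, and $Z^\lambda_{\sigma,w}$ is the sum of the weights of all admissible states. Local vanishing at a specialization of the variables means that the weight of every admissible state is zero there. Global vanishing means that $Z^\lambda_{\sigma,w}$ is zero there although not every admissible state has weight zero (the variables not being specialized remain independent indeterminates). *)

theory Defs
  imports Complex_Main "HOL-Library.FuncSet" "HOL-Combinatorics.Permutations"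
begin

text \<open>
  Colors are the natural numbers 1 and 2. A horizontal edge carries a spin of type
  \<open>nat option\<close>, where \<open>None\<close> is the uncolored spin \<open>+\<close>;
  a vertical edge carries a set of colors.
  Vertices are written in the order left, top, right, bottom.
\<close>

inductive vertex :: "nat option \<Rightarrow> nat set \<Rightarrow> nat option \<Rightarrow> nat set \<Rightarrow> bool" where
  v1: "vertex None S None S"
| v2: "vertex (Some c) S (Some c) S"
| v3: "c \<in> S \<Longrightarrow> vertex None S (Some c) (S - {c})"
| v4: "c \<notin> S \<Longrightarrow> vertex (Some c) S None (S \<union> {c})"
| v5: "c < d \<Longrightarrow> d \<in> S \<Longrightarrow> c \<notin> S \<Longrightarrow> vertex (Some c) S (Some d) ((S \<union> {c}) - {d})"
| v6: "c < d \<Longrightarrow> c \<in> S \<Longrightarrow> d \<notin> S \<Longrightarrow> vertex (Some d) S (Some c) ((S \<union> {d}) - {c})"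

text \<open>
  For an allowed vertex the bottom spin is determined by the other three, and the type
  (hence the weight) by the two horizontal spins and the top spin.
\<close>

definition vertex_weight ::
  "'a::field \<Rightarrow> 'a \<Rightarrow> 'a \<Rightarrow> nat option \<Rightarrow> nat set \<Rightarrow> nat option \<Rightarrow> nat set \<Rightarrow> 'a" where
  "vertex_weight t x y L S L' S' =
    (if \<not> vertex L S L' S' then 0 else
     (case (L, L') of
        (None, None) \<Rightarrow> (- t) ^ card S
      | (None, Some c) \<Rightarrow> (- t) ^ card {a \<in> S. a < c} * t ^ card {a \<in> S. a > c}
      | (Some c, None) \<Rightarrow> - (1 - t) * (x / y) * (- t) ^ card {a \<in> S. a > c}
      | (Some a, Some b) \<Rightarrow>
          (if a = b then
             t ^ card {e \<in> S. e > a} * (- (x / y) + t ^ (if a \<in> S then 1 else 0))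
           else if a < b then
             - (1 - t) * (x / y) * (- t) ^ card {e \<in> S. a < e \<and> e < b}
               * t ^ card {e \<in> S. e > b}
           else
             - (1 - t) * (- 1) ^ card {e \<in> S. b < e \<and> e < a} * t ^ card {e \<in> S. e > a})))"

text \<open>
  A state is a pair \<open>(h, v)\<close>. Columns are numbered from right to left, so in row \<open>i\<close>
  the vertex in column \<open>j\<close> has left edge \<open>h (i, j)\<close> and right edge \<open>h (i, j - 1)\<close>;
  thus \<open>h (i, 0)\<close> is the right and \<open>h (i, l1)\<close> the left boundary edge.
  Its top edge is \<open>v (i - 1, j)\<close> and its bottom edge is \<open>v (i, j)\<close>.
  Boundary edges are part of the assignment, with the prescribed values.
\<close>

type_synonym state = "(nat \<times> nat \<Rightarrow> nat option) \<times> (nat \<times> nat \<Rightarrow> nat set)"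

definition top_boundary :: "(nat \<Rightarrow> nat) \<Rightarrow> nat \<Rightarrow> nat \<Rightarrow> nat \<Rightarrow> nat set" where
  "top_boundary \<sigma> l1 l2 j =
    (if j = l1 then {\<sigma> 2} else {}) \<union> (if j = l2 then {\<sigma> 1} else {})"

definition admissible_states ::
  "(nat \<Rightarrow> nat) \<Rightarrow> (nat \<Rightarrow> nat) \<Rightarrow> nat \<Rightarrow> nat \<Rightarrow> state set" where
  "admissible_states \<sigma> w l1 l2 = {(h, v).
     h \<in> {1..2} \<times> {0..l1} \<rightarrow>\<^sub>E {None, Some 1, Some 2} \<and>
     v \<in> {0..2} \<times> {1..l1} \<rightarrow>\<^sub>E Pow {1, 2} \<and>
     (\<forall>j\<in>{1..l1}. v (0, j) = top_boundary \<sigma> l1 l2 j) \<and>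
     (\<forall>j\<in>{1..l1}. v (2, j) = {}) \<and>
     (\<forall>i\<in>{1..2}. h (i, l1) = None) \<and>
     (\<forall>i\<in>{1..2}. h (i, 0) = Some (w i)) \<and>
     (\<forall>i\<in>{1..2}. \<forall>j\<in>{1..l1}. vertex (h (i, j)) (v (i - 1, j)) (h (i, j - 1)) (v (i, j)))}"

definition state_weight ::
  "'a::field \<Rightarrow> (nat \<Rightarrow> 'a) \<Rightarrow> (nat \<Rightarrow> 'a) \<Rightarrow> nat \<Rightarrow> state \<Rightarrow> 'a" where
  "state_weight t x y l1 = (\<lambda>(h, v).
     \<Prod>i\<in>{1..2}. \<Prod>j\<in>{1..l1}.
       vertex_weight t (x i) (y j) (h (i, j)) (v (i - 1, j)) (h (i, j - 1)) (v (i, j)))"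

definition partition_function ::
  "'a::field \<Rightarrow> (nat \<Rightarrow> 'a) \<Rightarrow> (nat \<Rightarrow> 'a) \<Rightarrow> (nat \<Rightarrow> nat) \<Rightarrow> (nat \<Rightarrow> nat) \<Rightarrow> nat \<Rightarrow> nat \<Rightarrow> 'a" where
  "partition_function t x y \<sigma> w l1 l2 =
     (\<Sum>s\<in>admissible_states \<sigma> w l1 l2. state_weight t x y l1 s)"

definition local_vanishing ::
  "'a::field \<Rightarrow> (nat \<Rightarrow> 'a) \<Rightarrow> (nat \<Rightarrow> 'a) \<Rightarrow> (nat \<Rightarrow> nat) \<Rightarrow> (nat \<Rightarrow> nat) \<Rightarrow> nat \<Rightarrow> nat \<Rightarrow> bool" where
  "local_vanishing t x y \<sigma> w l1 l2 \<longleftrightarrow>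
     (\<forall>s\<in>admissible_states \<sigma> w l1 l2. state_weight t x y l1 s = 0)"

definition global_vanishing ::
  "'a::field \<Rightarrow> (nat \<Rightarrow> 'a) \<Rightarrow> (nat \<Rightarrow> 'a) \<Rightarrow> (nat \<Rightarrow> nat) \<Rightarrow> (nat \<Rightarrow> nat) \<Rightarrow> nat \<Rightarrow> nat \<Rightarrow> bool" where
  "global_vanishing t x y \<sigma> w l1 l2 \<longleftrightarrow>
     partition_function t x y \<sigma> w l1 l2 = 0 \<and> \<not> local_vanishing t x y \<sigma> w l1 l2"

text \<open>
  The variables are specialized to elements of an arbitrary field. Variables that are kept
  as independent indeterminates are elements satisfying no nontrivial polynomial
  relation over the prime field; the monomials in \<open>(u i)\<close>, \<open>i \<in> I\<close>, are given by their exponent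
  functions, and prime field coefficients are images of integers.
\<close>

definition independent_indeterminates :: "'i set \<Rightarrow> ('i \<Rightarrow> 'a::field) \<Rightarrow> bool" where
  "independent_indeterminates I u \<longleftrightarrow>
     (\<forall>(M :: ('i \<Rightarrow> nat) set) (c :: ('i \<Rightarrow> nat) \<Rightarrow> int).
        finite M \<longrightarrow> M \<subseteq> (I \<rightarrow>\<^sub>E UNIV) \<longrightarrow>
        (\<Sum>m\<in>M. of_int (c m) * (\<Prod>i\<in>I. u i ^ m i)) = 0 \<longrightarrow>
        (\<forall>m\<in>M. of_int (c m) = (0 :: 'a)))"

end

theory Submission imports Defs
begin

text \<open>
  Every vertex conserves color: what enters from the left and from the top leaves to the right
  and to the bottom (\<open>vertex_conserves_color\<close>). Summed over the columns to the left of a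
  horizontal edge, this says that the spin of the edge is the difference between the colors that
  came in from above and those that went out below (\<open>row_conserves_color\<close>). The bottom
  boundary is empty, so row 2 takes in only the color \<open>w 2\<close> that it
  releases on the right, and row 1 must therefore drop exactly this color, in a single column \<open>p\<close>. Hence \<open>p\<close>
  determines the whole state (\<open>admissible_states_eq\<close>). An edge of row 1 cannot carry two
  colors, so \<open>l2 \<le> p\<close>. If \<open>\<sigma> = w\<close>, the dropped color enters in column \<open>l1\<close> and
  \<open>p\<close> can be anything up to \<open>l1\<close>; otherwise it enters in column \<open>l2\<close>, which
  forces \<open>p = l2\<close>.

  The weight of each state is then an explicit product. For \<open>\<sigma> \<noteq> w\<close> the only state has weight
  \[ C \prod_{j < l_1} (1 - x_1/y_j) \prod_{j < l_2} (1 - x_2/y_j) \]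
  with \<open>C\<close> one of \<open>1\<close>, \<open>t\<close>, \<open>- t\<close>, from which the zeros are read off. For
  \<open>\<sigma> = w = id\<close> all weights contain the factors \<open>1 - x i / y j\<close> with \<open>j < l2\<close>, whence
  the local vanishing. On the locus \<open>x 2 = x 1 / t\<close> the sum over the states
  with \<open>l2 < p < l1\<close> telescopes (\<open>telescoping_sum\<close>), and together with the two end
  states it leaves the single product
  \[ - \prod_{j < l_1} (1 - x_1/y_j) \prod_{j < l_2} (1 - x_2/y_j), \]
  which vanishes at \<open>x 1 = y k\<close>. There the vanishing is not local, since the state
  \<open>p = l1\<close> has a weight whose zeros would need \<open>y k = y j\<close> with \<open>j \<noteq> k\<close> or
  \<open>y k = t * y j\<close>, relations that independent variables do not satisfy.
\<close>

section \<open>Conservation of color\<close>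

text \<open>
  With the horizontal spins as explicit cases, simplification decides whether a concrete vertex is
  allowed.
\<close>
lemma vertex_iff:
  "vertex L S L' S' \<longleftrightarrow>
     (case L of
        None \<Rightarrow> (case L' of None \<Rightarrow> S' = S | Some c \<Rightarrow> c \<in> S \<and> S' = S - {c})
      | Some c \<Rightarrow> (case L' of
            None \<Rightarrow> c \<notin> S \<and> S' = insert c S
          | Some d \<Rightarrow> if c = d then S' = S else d \<in> S \<and> c \<notin> S \<and> S' = insert c S - {d}))"
  (is "_ \<longleftrightarrow> ?R")
proof
  show "vertex L S L' S' \<Longrightarrow> ?R"
    by (induction rule: vertex.induct) auto
next
  assume ?R
  then show "vertex L S L' S'"
    by (auto simp: vertex.simps not_less_iff_gr_or_eq split: option.splits if_splits)
qed

lemma vertex_conserves_color: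
  assumes "vertex L S L' S'"
  shows "of_bool (L = Some c) + of_bool (c \<in> S) = (of_bool (L' = Some c) + of_bool (c \<in> S') :: nat)"
  using assms by (induction rule: vertex.induct) auto

text \<open>
  Columns increase to the left, so the columns \<open>k > j\<close> are those that color has to pass
  before it reaches the edge \<open>h j\<close>; telescoping the conservation law over them determines
  this edge from the vertical edges alone.
\<close>
lemma row_conserves_color:
  fixes h :: "nat \<Rightarrow> nat option"
  assumes row: "\<forall>j\<in>{1..l}. vertex (h j) (T j) (h (j - 1)) (B j)"
    and left: "h l = None" and "j \<le> l"
  shows "(\<Sum>k\<in>{j<..l}. of_bool (c \<in> T k)) =
    (of_bool (h j = Some c) + (\<Sum>k\<in>{j<..l}. of_bool (c \<in> B k)) :: nat)"
  using \<open>j \<le> l\<close>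
proof (induction j rule: inc_induct)
  case base
  show ?case using left by simp
next
  case (step j)
  have split: "{j<..l} = insert (Suc j) {Suc j<..l}" using step.hyps by auto
  have "vertex (h (Suc j)) (T (Suc j)) (h j) (B (Suc j))"
    using row step.hyps by (metis Suc_leI atLeastAtMost_iff diff_Suc_1 le_add1 plus_1_eq_Suc)
  from vertex_conserves_color[OF this, of c] step.IH
  show ?case unfolding split by (simp del: sum_of_bool_eq)
qed

lemma permutes_12_cases:
  assumes "\<sigma> permutes {1, 2::nat}"
  obtains "\<sigma> 1 = 1" "\<sigma> 2 = 2" | "\<sigma> 1 = 2" "\<sigma> 2 = 1"
proof -
  have "\<sigma> 1 \<in> {1, 2}" "\<sigma> 2 \<in> {1, 2}"
    using permutes_in_image[OF assms] by auto
  moreover have "\<sigma> 1 \<noteq> \<sigma> 2"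
    using permutes_inj[OF assms] by (simp add: inj_eq)
  ultimately show thesis using that by auto
qed

lemma permutes_12_eq_iff:
  assumes "\<sigma> permutes {1, 2::nat}" "w permutes {1, 2}"
  shows "\<sigma> = w \<longleftrightarrow> \<sigma> 2 = w 2"
proof
  assume "\<sigma> 2 = w 2"
  then have "\<sigma> 1 = w 1"
    using permutes_12_cases[OF assms(1)] permutes_12_cases[OF assms(2)] by metis
  show "\<sigma> = w"
  proof
    fix i show "\<sigma> i = w i"
      using \<open>\<sigma> 1 = w 1\<close> \<open>\<sigma> 2 = w 2\<close> permutes_not_in[OF assms(1), of i] permutes_not_in[OF assms(2), of i]
      by (cases "i \<in> {1, 2}") auto
  qed
qed simp

section \<open>The admissible states\<close>

text \<open>
  The state in which row 1 hands the color \<open>w 2\<close> down to row 2 in column \<open>p\<close>. If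
  \<open>\<sigma> = w\<close>, the color \<open>\<sigma> 2 = w 2\<close> enters in column \<open>l1\<close> and travels along row 1
  from there to column \<open>p\<close>, and the color
  \<open>\<sigma> 1 = w 1\<close> travels from column \<open>l2\<close> to the right boundary. If \<open>\<sigma> \<noteq> w\<close>
  and \<open>p = l2\<close>, then \<open>\<sigma> 2 = w 1\<close>, and the first two cases describe one path of this
  color from column \<open>l1\<close> to the right boundary.
\<close>
definition drop_state :: "(nat \<Rightarrow> nat) \<Rightarrow> (nat \<Rightarrow> nat) \<Rightarrow> nat \<Rightarrow> nat \<Rightarrow> nat \<Rightarrow> state" where
  "drop_state \<sigma> w l1 l2 p =
    (restrict (\<lambda>(i, j).
       if i = 1 then
         (if j < l2 then Some (w 1) else if p \<le> j \<and> j < l1 then Some (\<sigma> 2) else None)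
       else (if j < p then Some (w 2) else None)) ({1..2} \<times> {0..l1}),
     restrict (\<lambda>(i, j).
       if i = 0 then top_boundary \<sigma> l1 l2 j else if i = 1 \<and> j = p then {w 2} else {})
       ({0..2} \<times> {1..l1}))"

definition drop_columns :: "(nat \<Rightarrow> nat) \<Rightarrow> (nat \<Rightarrow> nat) \<Rightarrow> nat \<Rightarrow> nat \<Rightarrow> nat set" where
  "drop_columns \<sigma> w l1 l2 = (if \<sigma> = w then {l2..l1} else {l2})"

lemma sum_of_bool_single:
  fixes p :: nat
  assumes "p \<le> l"
  shows "(\<Sum>k\<in>{j<..l}. of_bool (k = p \<and> P)) = (of_bool (P \<and> j < p) :: nat)"
proof -
  have "(\<Sum>k\<in>{j<..l}. of_bool (k = p \<and> P)) = (\<Sum>k\<in>{j<..l}. if k = p then of_bool P else (0::nat))"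
    by (rule sum.cong) auto
  then show ?thesis using assms by (auto simp: sum.delta)
qed

text \<open>
  Conservation in row 2 locates the unique column \<open>p\<close> whose middle edge is occupied, and
  conservation in row 1 then gives all horizontal spins. If \<open>p < l2\<close>, then the
  edge of row 1 on the right of column \<open>p + 1\<close> would carry both colors. If \<open>\<sigma> 1 = w 2\<close>, then this
  color enters in column \<open>l2\<close>, so it cannot have been dropped in a column \<open>p > l2\<close>.
\<close>
lemma admissible_imp_drop_state:
  assumes le: "l2 \<le> l1" "0 < l2" and \<sigma>: "\<sigma> permutes {1, 2}" and w: "w permutes {1, 2}"
    and s: "s \<in> admissible_states \<sigma> w l1 l2"
  shows "s \<in> drop_state \<sigma> w l1 l2 ` drop_columns \<sigma> w l1 l2"
proof -
  obtain h v where hv: "s = (h, v)" by fastforce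
  have hE: "h \<in> {1..2} \<times> {0..l1} \<rightarrow>\<^sub>E {None, Some 1, Some 2}"
    and vE: "v \<in> {0..2} \<times> {1..l1} \<rightarrow>\<^sub>E Pow {1, 2}"
    and top: "\<And>j. j \<in> {1..l1} \<Longrightarrow> v (0, j) = top_boundary \<sigma> l1 l2 j"
    and bot: "\<And>j. j \<in> {1..l1} \<Longrightarrow> v (2, j) = {}"
    and left: "h (1, l1) = None" "h (2, l1) = None"
    and right: "h (1, 0) = Some (w 1)" "h (2, 0) = Some (w 2)"
    and vert: "\<And>i. i \<in> {1..2} \<Longrightarrow>
      \<forall>j\<in>{1..l1}. vertex (h (i, j)) (v (i - 1, j)) (h (i, j - 1)) (v (i, j))"
    using s unfolding hv admissible_states_def by auto
  have distinct: "\<sigma> 1 \<noteq> \<sigma> 2" "w 1 \<noteq> w 2"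
    using permutes_inj[OF \<sigma>] permutes_inj[OF w] by (simp_all add: inj_eq)
  have cols: "\<sigma> 1 = w 2 \<and> \<sigma> 2 = w 1 \<or> \<sigma> 1 = w 1 \<and> \<sigma> 2 = w 2"
    using permutes_12_cases[OF \<sigma>] permutes_12_cases[OF w] by metis
  have row1: "(\<Sum>k\<in>{j<..l1}. of_bool (c \<in> v (0, k))) =
      (of_bool (h (1, j) = Some c) + (\<Sum>k\<in>{j<..l1}. of_bool (c \<in> v (1, k))) :: nat)"
    if "j \<le> l1" for c j
    using row_conserves_color[of l1 "\<lambda>j. h (1, j)" "\<lambda>j. v (0, j)" "\<lambda>j. v (1, j)"] vert[of 1] left that
    by simp
  have row2: "(\<Sum>k\<in>{j<..l1}. of_bool (c \<in> v (1, k))) = (of_bool (h (2, j) = Some c) :: nat)"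
    if "j \<le> l1" for c j
    using row_conserves_color[of l1 "\<lambda>j. h (2, j)" "\<lambda>j. v (1, j)" "\<lambda>j. v (2, j)" j c] vert[of 2]
      left that bot
    by simp
  \<comment> \<open>The right boundary of row 2 counts the middle edges, and it carries \<open>w 2\<close> once.\<close>
  have total: "(\<Sum>k\<in>{0<..l1}. of_bool (c \<in> v (1, k))) = (of_bool (c = w 2) :: nat)" for c
    using row2[of 0 c] right by auto
  have "(\<Sum>k\<in>{0<..l1}. of_bool (w 2 \<in> v (1, k))) = (1 :: nat)"
    unfolding total by simp
  from sum_eq_1_iff[THEN iffD1, OF _ this]
  have "\<exists>p\<in>{0<..l1}. w 2 \<in> v (1, p) \<and> (\<forall>k\<in>{0<..l1}. p \<noteq> k \<longrightarrow> w 2 \<notin> v (1, k))"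
    by (simp only: of_bool_eq_1_iff of_bool_eq_0_iff finite_greaterThanAtMost simp_thms)
  then obtain p where p: "p \<in> {0<..l1}" "w 2 \<in> v (1, p)"
    and p_unique: "\<forall>k\<in>{0<..l1}. k \<noteq> p \<longrightarrow> w 2 \<notin> v (1, k)"
    by metis
  have other: "c \<notin> v (1, k)" if "c \<noteq> w 2" "k \<in> {0<..l1}" for c k
    using total[of c] that by auto
  have mid: "v (1, k) = (if k = p then {w 2} else {})" if "k \<in> {1..l1}" for k
  proof -
    have "k \<in> {0<..l1}" using that by simp
    then have "c \<in> v (1, k) \<longleftrightarrow> c = w 2 \<and> k = p" for c
      using p p_unique other[of c k] by metis
    then show ?thesis by auto
  qed
  have mid_sum: "(\<Sum>k\<in>{j<..l1}. of_bool (c \<in> v (1, k))) = (of_bool (c = w 2 \<and> j < p) :: nat)" for c j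
  proof -
    have "(\<Sum>k\<in>{j<..l1}. of_bool (c \<in> v (1, k))) = (\<Sum>k\<in>{j<..l1}. of_bool (k = p \<and> c = w 2) :: nat)"
    proof (rule sum.cong[OF refl])
      fix k assume "k \<in> {j<..l1}"
      then have "k \<in> {1..l1}" by auto
      from mid[OF this] show "of_bool (c \<in> v (1, k)) = (of_bool (k = p \<and> c = w 2) :: nat)" by simp
    qed
    then show ?thesis using p sum_of_bool_single[of p l1 "c = w 2" j] by simp
  qed
  have top_sum: "(\<Sum>k\<in>{j<..l1}. of_bool (c \<in> v (0, k))) =
      (of_bool (c = \<sigma> 2 \<and> j < l1) + of_bool (c = \<sigma> 1 \<and> j < l2) :: nat)" for c j
  proof -
    have "(\<Sum>k\<in>{j<..l1}. of_bool (c \<in> v (0, k))) =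
        (\<Sum>k\<in>{j<..l1}. of_bool (k = l1 \<and> c = \<sigma> 2) + of_bool (k = l2 \<and> c = \<sigma> 1) :: nat)"
    proof (rule sum.cong[OF refl])
      fix k assume "k \<in> {j<..l1}"
      then have "k \<in> {1..l1}" by auto
      from top[OF this] show "of_bool (c \<in> v (0, k)) =
          (of_bool (k = l1 \<and> c = \<sigma> 2) + of_bool (k = l2 \<and> c = \<sigma> 1) :: nat)"
        using distinct by (auto simp: top_boundary_def)
    qed
    then show ?thesis using le sum_of_bool_single[of l1 l1 "c = \<sigma> 2" j] sum_of_bool_single[of l2 l1 "c = \<sigma> 1" j]
      by (simp add: sum.distrib)
  qed
  have h2: "h (2, j) = (if j < p then Some (w 2) else None)" if "j \<le> l1" for j
  proof -
    have "c = w 2 \<and> j < p \<longleftrightarrow> h (2, j) = Some c" for c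
      using row2[OF that, of c] unfolding mid_sum by (simp only: of_bool_eq_iff)
    then show ?thesis by (cases "h (2, j)") auto
  qed
  \<comment> \<open>A given color enters row 1 at most once, so the numerical balance is a Boolean one.\<close>
  have balance: "(H \<longleftrightarrow> (A \<or> B) \<and> \<not> D) \<and> (D \<longrightarrow> A \<or> B)"
    if "of_bool A + of_bool B = (of_bool H + of_bool D :: nat)" "\<not> (A \<and> B)" for A B H D
    using that by (cases A; cases B; cases H; cases D) simp_all
  have flux: "h (1, j) = Some c \<longleftrightarrow> (c = \<sigma> 2 \<and> j < l1 \<or> c = \<sigma> 1 \<and> j < l2) \<and> \<not> (c = w 2 \<and> j < p)"
    and source: "c = w 2 \<and> j < p \<longrightarrow> c = \<sigma> 2 \<and> j < l1 \<or> c = \<sigma> 1 \<and> j < l2"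
    if "j \<le> l1" for c j
    using balance[OF row1[OF that, of c, unfolded mid_sum top_sum]] distinct by metis+
  have "l2 \<le> p"
  proof (rule ccontr)
    assume "\<not> l2 \<le> p"
    then have "h (1, p) = Some (\<sigma> 1)" "h (1, p) = Some (\<sigma> 2)"
      using flux[of p] le by auto
    then show False using distinct by simp
  qed
  have "p = l2" if "\<sigma> 1 = w 2"
    using source[of l2 "\<sigma> 1"] le distinct that \<open>l2 \<le> p\<close> by auto
  then have pcol: "p \<in> drop_columns \<sigma> w l1 l2"
    using p \<open>l2 \<le> p\<close> cols permutes_12_eq_iff[OF \<sigma> w] by (auto simp: drop_columns_def)
  have h1: "h (1, j) = (if j < l2 then Some (w 1) else if p \<le> j \<and> j < l1 then Some (\<sigma> 2) else None)"
    (is "_ = ?r") if "j \<le> l1" for j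
  proof -
    have "h (1, j) = Some c \<longleftrightarrow> ?r = Some c" for c
      using cols
    proof (elim disjE conjE)
      assume "\<sigma> 1 = w 2" "\<sigma> 2 = w 1"
      with \<open>\<sigma> 1 = w 2 \<Longrightarrow> p = l2\<close> le distinct flux[OF that, of c] show ?thesis
        by (cases "j < l2"; cases "j < l1") auto
    next
      assume "\<sigma> 1 = w 1" "\<sigma> 2 = w 2"
      with \<open>l2 \<le> p\<close> le distinct flux[OF that, of c] show ?thesis
        by (cases "j < l2"; cases "j < p"; cases "j < l1") auto
    qed
    then show ?thesis by (metis not_None_eq)
  qed
  have "h = fst (drop_state \<sigma> w l1 l2 p)"
  proof
    fix ij :: "nat \<times> nat"
    obtain i j where ij: "ij = (i, j)" by fastforce
    show "h ij = fst (drop_state \<sigma> w l1 l2 p) ij"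
    proof (cases "ij \<in> {1..2} \<times> {0..l1}")
      case True
      then have "i = 1 \<or> i = 2" "j \<le> l1" unfolding ij by auto
      with True h1[of j] h2[of j] show ?thesis unfolding ij by (auto simp: drop_state_def)
    next
      case False
      then show ?thesis using PiE_arb[OF hE False] by (simp add: drop_state_def restrict_def)
    qed
  qed
  moreover have "v = snd (drop_state \<sigma> w l1 l2 p)"
  proof
    fix ij :: "nat \<times> nat"
    obtain i j where ij: "ij = (i, j)" by fastforce
    show "v ij = snd (drop_state \<sigma> w l1 l2 p) ij"
    proof (cases "ij \<in> {0..2} \<times> {1..l1}")
      case True
      then have "i = 0 \<or> i = 1 \<or> i = 2" "j \<in> {1..l1}" unfolding ij by auto
      with True top[of j] mid[of j] bot[of j] show ?thesis unfolding ij by (auto simp: drop_state_def)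
    next
      case False
      then show ?thesis using PiE_arb[OF vE False] by (simp add: drop_state_def restrict_def)
    qed
  qed
  ultimately show ?thesis using pcol hv by (metis imageI prod.collapse)
qed

lemma drop_state_admissible:
  assumes le: "l2 \<le> l1" "0 < l2" and \<sigma>: "\<sigma> permutes {1, 2}" and w: "w permutes {1, 2}"
    and p: "p \<in> drop_columns \<sigma> w l1 l2"
  shows "drop_state \<sigma> w l1 l2 p \<in> admissible_states \<sigma> w l1 l2"
proof -
  have range: "l2 \<le> p" "p \<le> l1" using p le by (auto simp: drop_columns_def split: if_splits)
  have cases: "\<sigma> 1 = w 1 \<and> \<sigma> 2 = w 2 \<and> w 1 \<noteq> w 2 \<or>
      \<sigma> 1 = w 2 \<and> \<sigma> 2 = w 1 \<and> w 1 \<noteq> w 2 \<and> p = l2"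
    using p permutes_12_eq_iff[OF \<sigma> w] permutes_12_cases[OF \<sigma>] permutes_12_cases[OF w]
    by (smt (verit, best) drop_columns_def numeral_eq_one_iff semiring_norm(85) singletonD)
  have colors: "\<sigma> 1 \<in> {1, 2}" "\<sigma> 2 \<in> {1, 2}" "w 1 \<in> {1, 2}" "w 2 \<in> {1, 2}"
    using permutes_in_image[OF \<sigma>] permutes_in_image[OF w] by auto
  obtain h v where hv: "drop_state \<sigma> w l1 l2 p = (h, v)" by fastforce
  have h1: "h (Suc 0, j) = (if j < l2 then Some (w 1) else if p \<le> j \<and> j < l1 then Some (\<sigma> 2) else None)"
    and h2: "h (2, j) = (if j < p then Some (w 2) else None)" if "j \<le> l1" for j
    using hv that by (auto simp: drop_state_def)
  have v: "v (0, j) = top_boundary \<sigma> l1 l2 j" "v (Suc 0, j) = (if j = p then {w 2} else {})" "v (2, j) = {}"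
    if "j \<in> {1..l1}" for j
    using hv that by (auto simp: drop_state_def)
  have vert1: "vertex (h (1, j)) (v (0, j)) (h (1, j - 1)) (v (1, j))" if "j \<in> {1..l1}" for j
  proof -
    have "j - 1 < l2 \<longleftrightarrow> j \<le> l2" "p \<le> j - 1 \<longleftrightarrow> p < j" "j - 1 < l1" "j \<le> l1" "j - 1 \<le> l1"
      using that by auto
    then show ?thesis using that le range cases
      by (auto simp: vertex_iff h1 v top_boundary_def)
  qed
  have vert2: "vertex (h (2, j)) (v (1, j)) (h (2, j - 1)) (v (2, j))" if "j \<in> {1..l1}" for j
  proof -
    have "j - 1 < p \<longleftrightarrow> j \<le> p" "j \<le> l1" "j - 1 \<le> l1" using that by auto
    then show ?thesis using that by (auto simp: vertex_iff h2 v)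
  qed
  have hE: "h \<in> {1..2} \<times> {0..l1} \<rightarrow>\<^sub>E {None, Some 1, Some 2}"
    using hv colors by (auto simp: drop_state_def split: if_splits)
  have vE: "v \<in> {0..2} \<times> {1..l1} \<rightarrow>\<^sub>E Pow {1, 2}"
  proof (rule PiE_I)
    fix ij :: "nat \<times> nat" assume "ij \<in> {0..2} \<times> {1..l1}"
    then obtain i j where "ij = (i, j)" "i = 0 \<or> i = Suc 0 \<or> i = 2" "j \<in> {1..l1}"
      by force
    moreover have "top_boundary \<sigma> l1 l2 j \<subseteq> {1, 2}"
      unfolding top_boundary_def using colors(1,2) by simp
    ultimately show "v ij \<in> Pow {1, 2}" using v[of j] colors(4) by (auto split: if_splits)
  next
    fix ij :: "nat \<times> nat" assume "ij \<notin> {0..2} \<times> {1..l1}"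
    then show "v ij = undefined"
      using hv[symmetric] by (simp only: drop_state_def prod.inject restrict_apply if_False)
  qed
  have two: "{Suc 0..2} = {Suc 0, 2}" by auto
  show ?thesis
    unfolding hv admissible_states_def mem_Collect_eq prod.case
  proof (intro conjI ballI hE vE)
    fix i j assume ij: "i \<in> {1..2::nat}" "j \<in> {1..l1}"
    then have "i = 1 \<or> i = 2" by auto
    then show "vertex (h (i, j)) (v (i - 1, j)) (h (i, j - 1)) (v (i, j))"
      using vert1[OF ij(2)] vert2[OF ij(2)] by auto
  qed (use le range v h1 h2 two in auto)
qed

lemma admissible_states_eq:
  assumes "l2 \<le> l1" "0 < l2" "\<sigma> permutes {1, 2}" "w permutes {1, 2}"
  shows "admissible_states \<sigma> w l1 l2 = drop_state \<sigma> w l1 l2 ` drop_columns \<sigma> w l1 l2"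
  using admissible_imp_drop_state[OF assms] drop_state_admissible[OF assms] by blast

text \<open>The middle edges show the column \<open>p\<close>, so the states can be counted by it.\<close>
lemma inj_on_drop_state:
  assumes "l2 \<le> l1" "0 < l2"
  shows "inj_on (drop_state \<sigma> w l1 l2) (drop_columns \<sigma> w l1 l2)"
proof (rule inj_onI)
  fix p q
  assume pq: "p \<in> drop_columns \<sigma> w l1 l2" "q \<in> drop_columns \<sigma> w l1 l2"
    and eq: "drop_state \<sigma> w l1 l2 p = drop_state \<sigma> w l1 l2 q"
  have "1 \<le> p" "p \<le> l1"
    using pq assms by (auto simp: drop_columns_def split: if_splits)
  moreover have "snd (drop_state \<sigma> w l1 l2 p) (1, p) = snd (drop_state \<sigma> w l1 l2 q) (1, p)"
    using eq by simp
  ultimately show "p = q" by (auto simp: drop_state_def split: if_splits)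
qed

section \<open>Weights\<close>
lemma prod_if_less:
  fixes f :: "nat \<Rightarrow> 'a::comm_monoid_mult"
  assumes "p \<le> Suc l"
  shows "(\<Prod>j\<in>{1..l}. if j < p then f j else 1) = (\<Prod>j\<in>{1..<p}. f j)"
proof -
  have "{1..l} \<inter> {j. j < p} = {1..<p}" using assms by auto
  then show ?thesis by (simp add: prod.If_cases)
qed

text \<open>
  Row 2 always contributes \<open>1 - x 2 / y j\<close> for each column \<open>j < p\<close> that its single color
  crosses, and \<open>1\<close> elsewhere. The premise evaluates row 1 with the spin right of column
  \<open>j\<close> written as a function of \<open>j\<close> instead of \<open>j - 1\<close>.
\<close>
lemma state_weight_drop_state:
  assumes le: "l2 \<le> p" "p \<le> l1" "0 < l2"
    and row1: "\<And>j. 1 \<le> j \<Longrightarrow> j \<le> l1 \<Longrightarrow>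
      vertex_weight t (x 1) (y j)
        (if j < l2 then Some (w 1) else if p \<le> j \<and> j < l1 then Some (\<sigma> 2) else None)
        (top_boundary \<sigma> l1 l2 j)
        (if j \<le> l2 then Some (w 1) else if p < j then Some (\<sigma> 2) else None)
        (if j = p then {w 2} else {}) = f j"
  shows "state_weight t x y l1 (drop_state \<sigma> w l1 l2 p) =
    (\<Prod>j\<in>{1..l1}. f j) * (\<Prod>j\<in>{1..<p}. 1 - x 2 / y j)"
proof -
  obtain h v where hv: "drop_state \<sigma> w l1 l2 p = (h, v)" by fastforce
  have two: "{Suc 0..2} = {Suc 0, 2}" by auto
  have "(\<Prod>j\<in>{1..l1}. vertex_weight t (x 1) (y j) (h (1, j)) (v (0, j)) (h (1, j - 1)) (v (1, j)))
      = (\<Prod>j\<in>{1..l1}. f j)"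
  proof (rule prod.cong[OF refl])
    fix j assume j: "j \<in> {1..l1}"
    have "j - 1 < l2 \<longleftrightarrow> j \<le> l2" "p \<le> j - 1 \<and> j - 1 < l1 \<longleftrightarrow> p < j" using j by auto
    then have
      "h (1, j) = (if j < l2 then Some (w 1) else if p \<le> j \<and> j < l1 then Some (\<sigma> 2) else None)"
      "h (1, j - 1) = (if j \<le> l2 then Some (w 1) else if p < j then Some (\<sigma> 2) else None)"
      "v (0, j) = top_boundary \<sigma> l1 l2 j" "v (1, j) = (if j = p then {w 2} else {})"
      using hv j by (auto simp: drop_state_def)
    then show "vertex_weight t (x 1) (y j) (h (1, j)) (v (0, j)) (h (1, j - 1)) (v (1, j)) = f j"
      using row1[of j] j by (simp only: atLeastAtMost_iff)
  qed
  moreover have "(\<Prod>j\<in>{1..l1}. vertex_weight t (x 2) (y j) (h (2, j)) (v (1, j)) (h (2, j - 1)) (v (2, j)))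
      = (\<Prod>j\<in>{1..l1}. if j < p then 1 - x 2 / y j else 1)"
  proof (rule prod.cong[OF refl])
    fix j assume j: "j \<in> {1..l1}"
    have "j - 1 < p \<longleftrightarrow> j \<le> p" using j by auto
    moreover have "h (2, j) = (if j < p then Some (w 2) else None)"
      "h (2, j - 1) = (if j - 1 < p then Some (w 2) else None)"
      "v (1, j) = (if j = p then {w 2} else {})" "v (2, j) = {}"
      using hv j by (auto simp: drop_state_def)
    ultimately show "vertex_weight t (x 2) (y j) (h (2, j)) (v (1, j)) (h (2, j - 1)) (v (2, j))
        = (if j < p then 1 - x 2 / y j else 1)"
      by (auto simp: vertex_weight_def vertex_iff Collect_conv_if conj_disj_distribR Collect_disj_eq)
  qed
  ultimately show ?thesis
    using le prod_if_less[of p l1 "\<lambda>j. 1 - x 2 / y j"] by (simp add: state_weight_def hv two)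
qed

text \<open>
  The color \<open>w 1 = \<sigma> 2\<close> crosses every column \<open>j < l1\<close> of row 1, which gives the first product.
  Only column \<open>l2\<close>, where the other color passes through vertically, has a further factor
  \<open>C\<close>: there the two colors meet in a vertex of type (3) if \<open>l1 = l2\<close> and of type (2)
  otherwise.
\<close>
lemma state_weight_mismatch:
  fixes t :: "'a::field"
  assumes le: "l2 \<le> l1" "0 < l2" and \<sigma>: "\<sigma> permutes {1, 2}" and w: "w permutes {1, 2}"
    and ne: "\<sigma> \<noteq> w"
  defines "C \<equiv> (if l1 = l2 then (if w 1 = 1 then t else - t) else (if w 1 = 1 then t else 1))"
  shows "state_weight t x y l1 (drop_state \<sigma> w l1 l2 l2) =
    C * (\<Prod>j\<in>{1..<l1}. 1 - x 1 / y j) * (\<Prod>j\<in>{1..<l2}. 1 - x 2 / y j)"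
proof -
  have cases: "\<sigma> 1 = 1 \<and> \<sigma> 2 = 2 \<and> w 1 = 2 \<and> w 2 = 1 \<or> \<sigma> 1 = 2 \<and> \<sigma> 2 = 1 \<and> w 1 = 1 \<and> w 2 = 2"
    using ne permutes_12_eq_iff[OF \<sigma> w] permutes_12_cases[OF \<sigma>] permutes_12_cases[OF w] by metis
  have "state_weight t x y l1 (drop_state \<sigma> w l1 l2 l2) =
      (\<Prod>j\<in>{1..l1}. (if j < l1 then 1 - x 1 / y j else 1) * (if j = l2 then C else 1))
        * (\<Prod>j\<in>{1..<l2}. 1 - x 2 / y j)"
  proof (rule state_weight_drop_state)
    fix j assume "1 \<le> j" "j \<le> l1"
    then consider "j < l2" | "j = l2" "l2 = l1" | "j = l2" "l2 < l1" | "l2 < j" "j < l1" | "l2 < j" "j = l1"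
      using le by linarith
    then show "vertex_weight t (x 1) (y j)
        (if j < l2 then Some (w 1) else if l2 \<le> j \<and> j < l1 then Some (\<sigma> 2) else None)
        (top_boundary \<sigma> l1 l2 j)
        (if j \<le> l2 then Some (w 1) else if l2 < j then Some (\<sigma> 2) else None)
        (if j = l2 then {w 2} else {})
      = (if j < l1 then 1 - x 1 / y j else 1) * (if j = l2 then C else 1)"
      using cases le
      by (cases; elim disjE conjE; simp add: vertex_weight_def vertex_iff top_boundary_def C_def
          Collect_conv_if conj_disj_distribR Collect_disj_eq insert_Diff_if)
  qed (use le in auto)
  moreover have "(\<Prod>j\<in>{1..l1}. (if j < l1 then 1 - x 1 / y j else 1) * (if j = l2 then C else 1))
      = (\<Prod>j\<in>{1..<l1}. 1 - x 1 / y j) * C"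
    using le prod_if_less[of l1 l1 "\<lambda>j. 1 - x 1 / y j"] by (simp add: prod.distrib prod.delta)
  ultimately show ?thesis by (simp add: mult_ac)
qed

text \<open>
  In row 1 the color 1 crosses the columns \<open>j < l2\<close> and the color 2 the columns strictly between
  \<open>p\<close> and \<open>l1\<close>. The factor \<open>E\<close> is the weight of the vertex in column \<open>p\<close>, where the
  color 2 is dropped: at \<open>p = l1\<close> it goes straight down, at \<open>p = l2 < l1\<close> it is
  exchanged for the color 1 by a vertex of type (6), and between these it leaves by a vertex of
  type (4).
\<close>
lemma state_weight_identity:
  fixes t :: "'a::field" and x y :: "nat \<Rightarrow> 'a"
  assumes le: "0 < l2" "l2 \<le> p" "p \<le> l1"
  defines "E \<equiv> (if p = l1 then (if l1 = l2 then t else - t)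
     else if p = l2 then - (1 - t) else - (1 - t) * (x 1 / y p))"
  shows "state_weight t x y l1 (drop_state id id l1 l2 p) =
    (\<Prod>j\<in>{1..<l2}. 1 - x 1 / y j) * E * (\<Prod>j\<in>{p<..<l1}. 1 - x 1 / y j)
      * (\<Prod>j\<in>{1..<p}. 1 - x 2 / y j)"
proof -
  let ?u = "\<lambda>j. 1 - x 1 / y j"
  let ?f = "\<lambda>j. (if j < l2 then ?u j else 1) * (if j = p then E else 1)
      * (if j \<in> {p<..<l1} then ?u j else 1)"
  have "state_weight t x y l1 (drop_state id id l1 l2 p) =
      (\<Prod>j\<in>{1..l1}. ?f j) * (\<Prod>j\<in>{1..<p}. 1 - x 2 / y j)"
  proof (rule state_weight_drop_state)
    fix j assume "1 \<le> j" "j \<le> l1"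
    then show "vertex_weight t (x 1) (y j)
        (if j < l2 then Some (id 1) else if p \<le> j \<and> j < l1 then Some (id 2) else None)
        (top_boundary id l1 l2 j)
        (if j \<le> l2 then Some (id 1) else if p < j then Some (id 2) else None)
        (if j = p then {id 2} else {})
      = ?f j"
      using le
      by (cases "j < l2"; cases "j = l2"; cases "j = p"; cases "j = l1")
        (auto simp: vertex_weight_def vertex_iff top_boundary_def Collect_conv_if conj_disj_distribR Collect_disj_eq E_def)
  qed (use le in auto)
  moreover have "(\<Prod>j\<in>{1..l1}. if j \<in> {p<..<l1} then ?u j else 1) = (\<Prod>j\<in>{p<..<l1}. ?u j)"
  proof -
    have "{1..l1} \<inter> {p<..<l1} = {p<..<l1}" by auto
    then show ?thesis using prod.inter_restrict[of "{1..l1}" ?u "{p<..<l1}"] by simp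
  qed
  moreover have "(\<Prod>j\<in>{1..l1}. if j < l2 then ?u j else 1) = (\<Prod>j\<in>{1..<l2}. ?u j)"
    using le by (intro prod_if_less) auto
  ultimately show ?thesis
    using le by (simp add: prod.distrib prod.delta)
qed

section \<open>Evaluation along \<open>x\<^sub>1 = t x\<^sub>2\<close>\<close>

text \<open>
  Let \<open>A p\<close> be the product of \<open>1 - u j\<close> over \<open>p \<le> j < l1\<close> and \<open>1 - u j / t\<close> over
  \<open>l2 \<le> j < p\<close>. Passing from \<open>p\<close> to \<open>p + 1\<close> exchanges one factor, and
  \<open>t * ((1 - u p / t) - (1 - u p)) = - (1 - t) * u p\<close> is exactly the coefficient in the sum.
\<close>
lemma telescoping_sum:
  fixes u :: "nat \<Rightarrow> 'a::field"
  assumes "t \<noteq> 0" and "l2 < l1"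
  shows "(\<Sum>p\<in>{l2<..<l1}. - (1 - t) * u p * (\<Prod>j\<in>{p<..<l1}. 1 - u j) * (\<Prod>j\<in>{l2..<p}. 1 - u j / t))
    = t * (\<Prod>j\<in>{l2..<l1}. 1 - u j / t) - t * (1 - u l2 / t) * (\<Prod>j\<in>{l2<..<l1}. 1 - u j)"
proof -
  define A where "A p = (\<Prod>j\<in>{p..<l1}. 1 - u j) * (\<Prod>j\<in>{l2..<p}. 1 - u j / t)" for p
  have set: "{l2<..<l1} = {Suc l2..<l1}" by auto
  have step: "- (1 - t) * u p * (\<Prod>j\<in>{p<..<l1}. 1 - u j) * (\<Prod>j\<in>{l2..<p}. 1 - u j / t)
      = t * A (Suc p) - t * A p" if "p \<in> {Suc l2..<l1}" for p
  proof -
    define a b where "a = (\<Prod>j\<in>{p<..<l1}. 1 - u j)" and "b = (\<Prod>j\<in>{l2..<p}. 1 - u j / t)"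
    have "{p..<l1} = insert p {p<..<l1}" "{Suc p..<l1} = {p<..<l1}" "{l2..<Suc p} = insert p {l2..<p}"
      using that by auto
    then have "A p = (1 - u p) * a * b" "A (Suc p) = a * ((1 - u p / t) * b)"
      by (simp_all add: A_def a_def b_def)
    then show ?thesis using \<open>t \<noteq> 0\<close>
      unfolding a_def[symmetric] b_def[symmetric] by (simp only:) (simp add: field_simps)
  qed
  have "(\<Sum>p\<in>{l2<..<l1}. - (1 - t) * u p * (\<Prod>j\<in>{p<..<l1}. 1 - u j) * (\<Prod>j\<in>{l2..<p}. 1 - u j / t))
      = (\<Sum>p\<in>{Suc l2..<l1}. t * A (Suc p) - t * A p)"
    unfolding set by (rule sum.cong[OF refl]) (use step in \<open>simp add: atLeastSucLessThan_greaterThanLessThan\<close>)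
  also have "\<dots> = t * A l1 - t * A (Suc l2)"
    using \<open>l2 < l1\<close> by (intro sum_Suc_diff'[of "Suc l2" l1 "\<lambda>p. t * A p"]) auto
  also have "\<dots> = t * (\<Prod>j\<in>{l2..<l1}. 1 - u j / t) - t * (1 - u l2 / t) * (\<Prod>j\<in>{l2<..<l1}. 1 - u j)"
    by (simp add: A_def set)
  finally show ?thesis .
qed

text \<open>
  The telescoped sum cancels the state \<open>p = l1\<close>. What remains, with the state
  \<open>p = l2\<close>, has the coefficient \<open>- (1 - t) - t * (1 - u l2 / t) = - (1 - u l2)\<close>, which supplies
  the missing factor for \<open>j = l2\<close>.
\<close>
lemma partition_function_identity:
  fixes t :: "'a::field"
  assumes t: "t \<noteq> 0" and le: "0 < l2" "l2 < l1" and x: "x 2 = x 1 / t"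
  shows "partition_function t x y id id l1 l2 =
    - ((\<Prod>j\<in>{1..<l1}. 1 - x 1 / y j) * (\<Prod>j\<in>{1..<l2}. 1 - x 2 / y j))"
proof -
  define u where "u j = x 1 / y j" for j
  define P where "P = (\<Prod>j\<in>{1..<l2}. 1 - u j)"
  define Q where "Q = (\<Prod>j\<in>{1..<l2}. 1 - u j / t)"
  define g where "g p = state_weight t x y l1 (drop_state id id l1 l2 p)" for p
  define M where "M = (\<Prod>j\<in>{l2<..<l1}. 1 - u j)"
  have x2: "x 2 / y j = u j / t" for j by (simp add: x u_def)
  have split: "(\<Prod>j\<in>{1..<p}. 1 - u j / t) = Q * (\<Prod>j\<in>{l2..<p}. 1 - u j / t)" if "l2 \<le> p" for p
    unfolding Q_def using that le by (intro prod.atLeastLessThan_concat[symmetric]) auto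
  note weight = state_weight_identity[of l2 _ l1 t x y, folded g_def, unfolded x2, folded u_def P_def]
  have "partition_function t x y id id l1 l2 = (\<Sum>p\<in>{l2..l1}. g p)"
    unfolding partition_function_def
    using admissible_states_eq[of l2 l1 id id] inj_on_drop_state[of l2 l1 id id] le
    by (simp add: permutes_id sum.reindex drop_columns_def g_def)
  also have "{l2..l1} = insert l1 (insert l2 {l2<..<l1})" using le by auto
  also have "(\<Sum>p\<in>\<dots>. g p) = g l1 + (g l2 + (\<Sum>p\<in>{l2<..<l1}. g p))" using le by simp
  also have "g l1 = P * Q * (- t * (\<Prod>j\<in>{l2..<l1}. 1 - u j / t))"
    using weight[of l1] le split[of l1] by (simp add: P_def)
  also have "g l2 = P * Q * (- (1 - t) * M)"
    using weight[of l2] le split[of l2] by (simp add: M_def P_def mult_ac)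
  also have "(\<Sum>p\<in>{l2<..<l1}. g p) = (\<Sum>p\<in>{l2<..<l1}. P * Q *
      (- (1 - t) * u p * (\<Prod>j\<in>{p<..<l1}. 1 - u j) * (\<Prod>j\<in>{l2..<p}. 1 - u j / t)))"
  proof (rule sum.cong[OF refl])
    fix p assume "p \<in> {l2<..<l1}"
    then show "g p = P * Q *
      (- (1 - t) * u p * (\<Prod>j\<in>{p<..<l1}. 1 - u j) * (\<Prod>j\<in>{l2..<p}. 1 - u j / t))"
      using weight[of p] le split[of p] by (simp add: P_def mult_ac)
  qed
  also have "\<dots> = P * Q * (t * (\<Prod>j\<in>{l2..<l1}. 1 - u j / t) - t * (1 - u l2 / t) * M)"
    unfolding M_def telescoping_sum[OF t le(2), symmetric] by (simp add: sum_distrib_left)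
  also have "P * Q * (- t * (\<Prod>j\<in>{l2..<l1}. 1 - u j / t)) + (P * Q * (- (1 - t) * M) +
      P * Q * (t * (\<Prod>j\<in>{l2..<l1}. 1 - u j / t) - t * (1 - u l2 / t) * M)) = - (P * ((1 - u l2) * M) * Q)"
    using t by (simp add: field_simps)
  also have "P * ((1 - u l2) * M) = (\<Prod>j\<in>{1..<l1}. 1 - u j)"
  proof -
    have "{l2..<l1} = insert l2 {l2<..<l1}" using le by auto
    then have "(1 - u l2) * M = (\<Prod>j\<in>{l2..<l1}. 1 - u j)" by (simp add: M_def)
    then show ?thesis
      using le prod.atLeastLessThan_concat[of 1 l2 l1 "\<lambda>j. 1 - u j"] by (simp add: P_def)
  qed
  finally show ?thesis by (simp only: Q_def x2 u_def)
qed

section \<open>Independence\<close>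

text \<open>
  Two equal monomials give the relation with coefficients \<open>1\<close> and \<open>- 1\<close>, which are nonzero
  in every characteristic.
\<close>
lemma independent_monomials_neq:
  fixes u :: "'i \<Rightarrow> 'a::field"
  assumes ind: "independent_indeterminates I u"
    and m: "m \<in> I \<rightarrow>\<^sub>E UNIV" "n \<in> I \<rightarrow>\<^sub>E UNIV" "m \<noteq> n"
  shows "(\<Prod>i\<in>I. u i ^ m i) \<noteq> (\<Prod>i\<in>I. u i ^ n i)"
proof
  assume eq: "(\<Prod>i\<in>I. u i ^ m i) = (\<Prod>i\<in>I. u i ^ n i)"
  define c :: "('i \<Rightarrow> nat) \<Rightarrow> int" where "c k = (if k = m then 1 else - 1)" for k
  have "(\<Sum>k\<in>{m, n}. of_int (c k) * (\<Prod>i\<in>I. u i ^ k i)) = 0"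
    using m eq by (simp add: c_def)
  then have "(of_int (c m) :: 'a) = 0"
    using ind[unfolded independent_indeterminates_def, rule_format, of "{m, n}" c m] m by auto
  then show False by (simp add: c_def)
qed

lemma indeterminate_neq_0:
  fixes t :: "'a::field"
  assumes "independent_indeterminates {()} (\<lambda>_. t)"
  shows "t \<noteq> 0"
  \<comment> \<open>Zero satisfies \<open>t = t\<^sup>2\<close>.\<close>
  using independent_monomials_neq[OF assms, of "\<lambda>_. 1" "\<lambda>_. 2"]
  by (auto simp: PiE_def extensional_def fun_eq_iff)

text \<open>
  Taking \<open>j = k\<close> in the second claim shows \<open>t \<noteq> 1\<close>, so that \<open>x 2 = y k / t\<close> differs from
  \<open>y k\<close> as well.
\<close>
lemma independent_variables_neq:
  fixes t :: "'a::field" and y :: "nat \<Rightarrow> 'a"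
  assumes ind: "independent_indeterminates {0..l} (y(0 := t))"
    and jk: "j \<in> {1..l}" "k \<in> {1..l}"
  shows "j \<noteq> k \<Longrightarrow> y k \<noteq> y j" "y k \<noteq> t * y j"
proof -
  let ?u = "y(0 := t)"
  let ?m = "\<lambda>f. restrict f {0..l} :: nat \<Rightarrow> nat"
  have single: "(\<Prod>i\<in>{0..l}. ?u i ^ of_bool (i = n)) = ?u n" if "n \<le> l" for n
  proof -
    have "(\<Prod>i\<in>{0..l}. ?u i ^ of_bool (i = n)) = (\<Prod>i\<in>{0..l}. if i = n then ?u i else 1)"
      by (rule prod.cong) auto
    then show ?thesis using that by (simp add: prod.delta)
  qed
  have neq: "(\<Prod>i\<in>{0..l}. ?u i ^ f i) \<noteq> (\<Prod>i\<in>{0..l}. ?u i ^ g i)"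
    if "n \<le> l" "f n \<noteq> g n" for f g n
  proof -
    have "?m f n \<noteq> ?m g n" using that by simp
    then have "?m f \<noteq> ?m g" by metis
    from independent_monomials_neq[OF ind _ _ this] show ?thesis by simp
  qed
  show "y k \<noteq> y j" if "j \<noteq> k"
    using neq[of k "\<lambda>i. of_bool (i = k)" "\<lambda>i. of_bool (i = j)"] jk that single[of j] single[of k]
    by simp
  show "y k \<noteq> t * y j"
    using neq[of 0 "\<lambda>i. of_bool (i = k)" "\<lambda>i. of_bool (i = 0) + of_bool (i = j)"] jk
      single[of 0] single[of j] single[of k]
    by (simp add: power_add prod.distrib)
qed

section \<open>Vanishing\<close>
lemma prod_one_minus_eq_0_iff:
  fixes a :: "'a::field" and y :: "nat \<Rightarrow> 'a"
  assumes "\<forall>j\<in>{1..<n}. y j \<noteq> 0"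
  shows "(\<Prod>j\<in>{1..<n}. 1 - a / y j) = 0 \<longleftrightarrow> (\<exists>k. 1 \<le> k \<and> k < n \<and> a = y k)"
  using assms by (auto simp: field_simps)

lemma mismatch_vanishing:
  fixes t :: "'a::field"
  assumes le: "l2 \<le> l1" "0 < l2" and \<sigma>: "\<sigma> permutes {1, 2}" and w: "w permutes {1, 2}"
    and ne: "\<sigma> \<noteq> w" and t: "t \<noteq> 0" and y: "\<forall>j\<in>{1..l1}. y j \<noteq> 0"
  shows "card (admissible_states \<sigma> w l1 l2) = 1"
    and "\<not> global_vanishing t x y \<sigma> w l1 l2"
    and "partition_function t x y \<sigma> w l1 l2 = 0 \<longleftrightarrow>
      (\<exists>k. 1 \<le> k \<and> k < l1 \<and> x 1 = y k) \<or> (\<exists>k. 1 \<le> k \<and> k < l2 \<and> x 2 = y k)"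
proof -
  have states: "admissible_states \<sigma> w l1 l2 = {drop_state \<sigma> w l1 l2 l2}"
    using admissible_states_eq[OF le \<sigma> w] ne by (simp add: drop_columns_def)
  then show "card (admissible_states \<sigma> w l1 l2) = 1" by simp
  show "\<not> global_vanishing t x y \<sigma> w l1 l2"
    by (simp add: global_vanishing_def local_vanishing_def partition_function_def states)
  have y': "\<forall>j\<in>{1..<l1}. y j \<noteq> 0" "\<forall>j\<in>{1..<l2}. y j \<noteq> 0" using y le by auto
  show "partition_function t x y \<sigma> w l1 l2 = 0 \<longleftrightarrow>
      (\<exists>k. 1 \<le> k \<and> k < l1 \<and> x 1 = y k) \<or> (\<exists>k. 1 \<le> k \<and> k < l2 \<and> x 2 = y k)"
    unfolding partition_function_def states state_weight_mismatch[OF le \<sigma> w ne]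
      prod_one_minus_eq_0_iff[OF y'(1), symmetric] prod_one_minus_eq_0_iff[OF y'(2), symmetric]
    using t by (simp add: state_weight_mismatch[OF le \<sigma> w ne])
qed

lemma identity_local_vanishing:
  fixes t :: "'a::field"
  assumes le: "l2 \<le> l1" "0 < l2" and y: "\<forall>j\<in>{1..l1}. y j \<noteq> 0"
    and i: "i \<in> {1, 2}" and k: "1 \<le> k" "k < l2" "x i = y k"
  shows "local_vanishing t x y id id l1 l2"
  unfolding local_vanishing_def
proof
  fix s assume "s \<in> admissible_states id id l1 l2"
  then obtain p where p: "l2 \<le> p" "p \<le> l1" and s: "s = drop_state id id l1 l2 p"
    using admissible_states_eq[OF le permutes_id permutes_id] by (auto simp: drop_columns_def)
  have y': "\<forall>j\<in>{1..<l2}. y j \<noteq> 0" "\<forall>j\<in>{1..<p}. y j \<noteq> 0" using y le p by auto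
  from i have "x 1 = y k \<or> x 2 = y k" using k by auto
  then have "(\<Prod>j\<in>{1..<l2}. 1 - x 1 / y j) = 0 \<or> (\<Prod>j\<in>{1..<p}. 1 - x 2 / y j) = 0"
    unfolding prod_one_minus_eq_0_iff[OF y'(1)] prod_one_minus_eq_0_iff[OF y'(2)]
    using k p by auto
  then show "state_weight t x y l1 s = 0"
    unfolding s state_weight_identity[OF le(2) p] by auto
qed

text \<open>
  The partition function vanishes by its product form. The witness against local vanishing is the
  state \<open>p = l1\<close>: its weight involves \<open>x 1\<close> only through the columns \<open>j < l2\<close>, so the
  column \<open>k\<close> does no harm.
\<close>
lemma identity_global_vanishing:
  fixes t :: "'a::field"
  assumes l2: "0 < l2" and y: "\<forall>j\<in>{1..l1}. y j \<noteq> 0" and t: "t \<noteq> 0"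
    and k: "l2 \<le> k" "k < l1" "x 1 = y k" "x 2 = inverse t * y k"
    and ind: "independent_indeterminates {0..l1} (y(0 := t))"
  shows "global_vanishing t x y id id l1 l2"
  unfolding global_vanishing_def
proof
  have y': "\<forall>j\<in>{1..<l2}. y j \<noteq> 0" "\<forall>j\<in>{1..<l1}. y j \<noteq> 0" using y k by auto
  have "x 2 = x 1 / t" using k by (simp add: field_simps)
  moreover have "(\<Prod>j\<in>{1..<l1}. 1 - x 1 / y j) = 0"
    unfolding prod_one_minus_eq_0_iff[OF y'(2)] using k l2 by (intro exI[of _ k]) auto
  ultimately show "partition_function t x y id id l1 l2 = 0"
    using partition_function_identity[OF t l2, of l1 x y] k by simp
  show "\<not> local_vanishing t x y id id l1 l2"
  proof
    assume "local_vanishing t x y id id l1 l2"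
    moreover have "drop_state id id l1 l2 l1 \<in> admissible_states id id l1 l2"
      using k l2 by (intro drop_state_admissible) (auto simp: drop_columns_def permutes_id)
    ultimately have "state_weight t x y l1 (drop_state id id l1 l2 l1) = 0"
      by (simp add: local_vanishing_def)
    then have "(\<Prod>j\<in>{1..<l2}. 1 - x 1 / y j) = 0 \<or> (\<Prod>j\<in>{1..<l1}. 1 - x 2 / y j) = 0"
      using state_weight_identity[of l2 l1 l1 t x y] k l2 t by auto
    then show False
      unfolding prod_one_minus_eq_0_iff[OF y'(1)] prod_one_minus_eq_0_iff[OF y'(2)]
    proof (elim disjE exE conjE)
      fix j assume "1 \<le> j" "j < l2" "x 1 = y j"
      then show False using independent_variables_neq(1)[OF ind, of j k] k by auto
    next
      fix j assume "1 \<le> j" "j < l1" "x 2 = y j"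
      then show False using independent_variables_neq(2)[OF ind, of j k] k t l2
        by (auto simp: field_simps)
    qed
  qed
qed

theorem proposition4p11:
  fixes t :: "'a::field" and x y :: "nat \<Rightarrow> 'a" and l1 l2 :: nat and \<sigma> w :: "nat \<Rightarrow> nat"
  assumes "l1 \<ge> l2" and "l2 > 0"
    and "\<sigma> permutes {1, 2}" and "w permutes {1, 2}"
    and "independent_indeterminates {()} (\<lambda>_. t)"
    and "\<forall>j\<in>{1..l1}. y j \<noteq> 0"
  shows
    "(\<sigma> \<noteq> w \<longrightarrow>
        card (admissible_states \<sigma> w l1 l2) = 1 \<and>
        \<not> global_vanishing t x y \<sigma> w l1 l2 \<and>
        (partition_function t x y \<sigma> w l1 l2 = 0 \<longleftrightarrow>
           (\<exists>k. 1 \<le> k \<and> k < l1 \<and> x 1 = y k) \<or> (\<exists>k. 1 \<le> k \<and> k < l2 \<and> x 2 = y k))) \<and>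
     (\<sigma> = id \<and> w = id \<longrightarrow>
        card (admissible_states \<sigma> w l1 l2) = l1 - l2 + 1 \<and>
        (\<forall>i\<in>{1, 2}. \<forall>k. 1 \<le> k \<and> k < l2 \<and> x i = y k \<longrightarrow>
           local_vanishing t x y \<sigma> w l1 l2) \<and>
        (\<forall>k. l2 \<le> k \<and> k < l1 \<and> x 1 = y k \<and> x 2 = inverse t * y k \<and>
           independent_indeterminates {0..l1} (y(0 := t)) \<longrightarrow>
           global_vanishing t x y \<sigma> w l1 l2))"
proof (intro conjI impI)
  have t: "t \<noteq> 0" using assms(5) by (rule indeterminate_neq_0)
  show "card (admissible_states \<sigma> w l1 l2) = 1" if "\<sigma> \<noteq> w" using mismatch_vanishing(1)[OF assms(1-4) that t assms(6)] .
  show "\<not> global_vanishing t x y \<sigma> w l1 l2" if "\<sigma> \<noteq> w" using mismatch_vanishing(2)[OF assms(1-4) that t assms(6)] .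
  show "partition_function t x y \<sigma> w l1 l2 = 0 \<longleftrightarrow>
      (\<exists>k. 1 \<le> k \<and> k < l1 \<and> x 1 = y k) \<or> (\<exists>k. 1 \<le> k \<and> k < l2 \<and> x 2 = y k)" if "\<sigma> \<noteq> w"
    using mismatch_vanishing(3)[OF assms(1-4) that t assms(6)] .
  assume id: "\<sigma> = id \<and> w = id"
  show "card (admissible_states \<sigma> w l1 l2) = l1 - l2 + 1"
    unfolding admissible_states_eq[OF assms(1-4)] card_image[OF inj_on_drop_state[OF assms(1,2)]]
    using id assms(1) by (simp add: drop_columns_def Suc_diff_le)
  show "\<forall>i\<in>{1, 2}. \<forall>k. 1 \<le> k \<and> k < l2 \<and> x i = y k \<longrightarrow> local_vanishing t x y \<sigma> w l1 l2"
    using id identity_local_vanishing[OF assms(1,2,6)] by blast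
  show "\<forall>k. l2 \<le> k \<and> k < l1 \<and> x 1 = y k \<and> x 2 = inverse t * y k \<and>
      independent_indeterminates {0..l1} (y(0 := t)) \<longrightarrow> global_vanishing t x y \<sigma> w l1 l2"
    using id identity_global_vanishing[OF assms(2,6) t] by blast
qed

end
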